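(* Let $\kappa$ be a regular cardinal and let $\bar a=\langle \mu_i: i<\kappa\rangle$ be an increasing sequence of regular cardinals. Then $|{\rm Pcut}(\bar a)|\leq 2^\kappa$. Moreover, if $2^\kappa=\aleph_\alpha$, then $|{\rm Pcut}(\bar a)|\leq |\alpha+1|^2$.
   Context: For an ultrafilter $D$ on $\kappa$ and functions $f,g\in\prod_{i<\kappa}\mu_i$, write $f<_D g$ iff $\{i<\kappa: f(i)<g(i)\}\in D$; this induces the linear order of the ultraproduct $\prod_{i<\kappa}\mu_i/D$. For infinite regular cardinals $\lambda_1,\lambda_2$, say that $(\lambda_1,\lambda_2)$ is the cofinality of a cut of $\prod_{i<\kappa}\mu_i/D$ if there are a $<_D$-increasing sequence $\langle f_\alpha:\alpha<\lambda_1\rangle$ and a $<_D$-decreasing sequence $\langle g_\xi:\xi<\lambda_2\rangle$ in $\prod_{i<\kappa}\mu_i$ such that $f_\alpha<_D g_\xi$ for all $\alpha<\lambda_1,\xi<\lambda_2$, and there is no $h\in\prod_{i<\kappa}\mu_i$ with $f_\alpha<_D h<_D g_\xi$ for all $\alpha<\lambda_1,\xi<\lambda_2$. Define ${\rm Pcut}(\bar a)$ to be the set of pairs $(\lambda_1,\lambda_2)$ with $\lambda_1,\lambda_2\geq\aleph_0$ such that for some ultrafilter $D$ on $\kappa$, $(\lambda_1,\lambda_2)$ is the cofinality of a cut of $\prod_{i<\kappa}\mu_i/D$. *)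

theory Defs
  imports Main "HOL-Library.FuncSet"
begin

unbundle cardinal_syntax

text \<open>
  Ordinals are well-orders and cardinals are the library's cardinal orders, both taken up to
  \<^const>\<open>ordIso\<close>; the elements of \<^term>\<open>Field r\<close> play the role of the ordinals below \<open>r\<close>.
\<close>

definition infinite_regular :: "'a rel \<Rightarrow> bool" where
  "infinite_regular r \<longleftrightarrow> cinfinite r \<and> Card_order r \<and> regularCard r"

definition ultrafilter_on :: "'a set \<Rightarrow> 'a set set \<Rightarrow> bool" where
  "ultrafilter_on S D \<longleftrightarrow>
     D \<subseteq> Pow S \<and> S \<in> D \<and> {} \<notin> D \<and>
     (\<forall>A\<in>D. \<forall>B\<in>D. A \<inter> B \<in> D) \<and>
     (\<forall>A\<in>D. \<forall>B. A \<subseteq> B \<and> B \<subseteq> S \<longrightarrow> B \<in> D) \<and>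
     (\<forall>A. A \<subseteq> S \<longrightarrow> A \<in> D \<or> S - A \<in> D)"

definition prod_mu :: "'k rel \<Rightarrow> ('k \<Rightarrow> 'm rel) \<Rightarrow> ('k \<Rightarrow> 'm) set" where
  "prod_mu k mu = (\<Pi>\<^sub>E i\<in>Field k. Field (mu i))"

definition less_D :: "'k rel \<Rightarrow> ('k \<Rightarrow> 'm rel) \<Rightarrow> 'k set set \<Rightarrow> ('k \<Rightarrow> 'm) \<Rightarrow> ('k \<Rightarrow> 'm) \<Rightarrow> bool" where
  "less_D k mu D f g \<longleftrightarrow> {i \<in> Field k. (f i, g i) \<in> mu i \<and> f i \<noteq> g i} \<in> D"

definition cut_cofinality ::
  "'k rel \<Rightarrow> ('k \<Rightarrow> 'm rel) \<Rightarrow> 'k set set \<Rightarrow> 'a rel \<Rightarrow> 'b rel \<Rightarrow> bool" where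
  "cut_cofinality k mu D l1 l2 \<longleftrightarrow>
     (\<exists>(f :: 'a \<Rightarrow> 'k \<Rightarrow> 'm) (g :: 'b \<Rightarrow> 'k \<Rightarrow> 'm).
        (\<forall>a\<in>Field l1. f a \<in> prod_mu k mu) \<and>
        (\<forall>x\<in>Field l2. g x \<in> prod_mu k mu) \<and>
        (\<forall>a b. (a, b) \<in> l1 \<and> a \<noteq> b \<longrightarrow> less_D k mu D (f a) (f b)) \<and>
        (\<forall>x y. (x, y) \<in> l2 \<and> x \<noteq> y \<longrightarrow> less_D k mu D (g y) (g x)) \<and>
        (\<forall>a\<in>Field l1. \<forall>x\<in>Field l2. less_D k mu D (f a) (g x)) \<and>
        \<not> (\<exists>h\<in>prod_mu k mu. \<forall>a\<in>Field l1. \<forall>x\<in>Field l2.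
              less_D k mu D (f a) h \<and> less_D k mu D h (g x)))"

text \<open>
  A cardinal counts once, so the members are pairs of \<^const>\<open>ordIso\<close>-classes. The classes live on
  the type of functions \<open>'k \<Rightarrow> 'm\<close>; this omits no cardinal, since a strictly monotone sequence in
  the product is injective (lemma \<open>Pcut_complete\<close> below).
\<close>

definition Pcut ::
  "'k rel \<Rightarrow> ('k \<Rightarrow> 'm rel) \<Rightarrow> (('k \<Rightarrow> 'm) rel set \<times> ('k \<Rightarrow> 'm) rel set) set" where
  "Pcut k mu =
     {(ordIso `` {l1}, ordIso `` {l2}) | (l1 :: ('k \<Rightarrow> 'm) rel) (l2 :: ('k \<Rightarrow> 'm) rel).
        infinite_regular l1 \<and> infinite_regular l2 \<and>
        (\<exists>D. ultrafilter_on (Field k) D \<and> cut_cofinality k mu D l1 l2)}"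

text \<open>
  \<open>is_aleph r c\<close> says \<open>c = \<aleph>\<^sub>\<alpha>\<close>, where \<open>\<alpha>\<close> is the order type of the well-order \<open>r\<close>; the relation
  \<^term>\<open>Restr r (underS r a)\<close> is the proper initial segment of \<open>r\<close> below \<open>a\<close>. In the limit clause it
  suffices to compare with cardinals on the type of \<open>c\<close>, as every cardinal below \<open>c\<close> occurs there.
\<close>

inductive is_aleph :: "'o rel \<Rightarrow> 'u rel \<Rightarrow> bool" where
  zero: "Card_order c \<Longrightarrow> c =o natLeq \<Longrightarrow> is_aleph {} c"
| succ: "Well_order r \<Longrightarrow> a \<in> Field r \<Longrightarrow> (\<And>b. b \<in> Field r \<Longrightarrow> (b, a) \<in> r) \<Longrightarrow>
    is_aleph (Restr r (underS r a)) d \<Longrightarrow> Card_order c \<Longrightarrow> c =o cardSuc d \<Longrightarrow>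
    is_aleph r c"
| limit: "Well_order r \<Longrightarrow> Field r \<noteq> {} \<Longrightarrow>
    (\<And>a. a \<in> Field r \<Longrightarrow> \<exists>b. (a, b) \<in> r \<and> a \<noteq> b) \<Longrightarrow>
    (\<And>a. a \<in> Field r \<Longrightarrow> is_aleph (Restr r (underS r a)) (A a)) \<Longrightarrow>
    Card_order c \<Longrightarrow> (\<And>a. a \<in> Field r \<Longrightarrow> A a \<le>o c) \<Longrightarrow>
    (\<And>d :: 'u rel. Card_order d \<Longrightarrow> (\<And>a. a \<in> Field r \<Longrightarrow> A a \<le>o d) \<Longrightarrow> c \<le>o d) \<Longrightarrow>
    is_aleph r c"

lemma ordIso_class_eq_iff:
  fixes r s :: "'a rel"
  assumes "Well_order r" "Well_order s"
  shows "ordIso `` {r} = (ordIso `` {s} :: 'a rel set) \<longleftrightarrow> r =o s"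
proof
  assume "ordIso `` {r} = (ordIso `` {s} :: 'a rel set)"
  moreover have "s \<in> ordIso `` {s}"
    using assms(2) ordIso_reflexive by auto
  ultimately have "s \<in> ordIso `` {r}"
    by simp
  then show "r =o s"
    by simp
next
  assume "r =o s"
  then show "ordIso `` {r} = (ordIso `` {s} :: 'a rel set)"
    by (auto intro: ordIso_transitive ordIso_symmetric)
qed

lemma cut_cofinality_dir_image:
  assumes cut: "cut_cofinality k mu D l1 l2"
    and p: "inj_on p (Field l1)" and q: "inj_on q (Field l2)"
  shows "cut_cofinality k mu D (dir_image l1 p) (dir_image l2 q)"
proof -
  obtain f g where fg:
    "\<forall>a\<in>Field l1. f a \<in> prod_mu k mu"
    "\<forall>x\<in>Field l2. g x \<in> prod_mu k mu"
    "\<forall>a b. (a, b) \<in> l1 \<and> a \<noteq> b \<longrightarrow> less_D k mu D (f a) (f b)"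
    "\<forall>x y. (x, y) \<in> l2 \<and> x \<noteq> y \<longrightarrow> less_D k mu D (g y) (g x)"
    "\<forall>a\<in>Field l1. \<forall>x\<in>Field l2. less_D k mu D (f a) (g x)"
    "\<not> (\<exists>h\<in>prod_mu k mu. \<forall>a\<in>Field l1. \<forall>x\<in>Field l2.
          less_D k mu D (f a) h \<and> less_D k mu D h (g x))"
    using cut unfolding cut_cofinality_def by blast
  define f' where "f' = f \<circ> inv_into (Field l1) p"
  define g' where "g' = g \<circ> inv_into (Field l2) q"
  have f': "f' (p a) = f a" if "a \<in> Field l1" for a
    using that p by (simp add: f'_def)
  have g': "g' (q x) = g x" if "x \<in> Field l2" for x
    using that q by (simp add: g'_def)
  have "\<forall>a b. (a, b) \<in> dir_image l1 p \<and> a \<noteq> b \<longrightarrow> less_D k mu D (f' a) (f' b)"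
  proof (intro allI impI)
    fix u v assume "(u, v) \<in> dir_image l1 p \<and> u \<noteq> v"
    then obtain a b where "u = p a" "v = p b" "(a, b) \<in> l1" "a \<noteq> b"
      unfolding dir_image_def by blast
    moreover from this have "a \<in> Field l1" "b \<in> Field l1"
      by (auto intro: FieldI1 FieldI2)
    ultimately show "less_D k mu D (f' u) (f' v)"
      using fg(3) f' by simp
  qed
  moreover have "\<forall>x y. (x, y) \<in> dir_image l2 q \<and> x \<noteq> y \<longrightarrow> less_D k mu D (g' y) (g' x)"
  proof (intro allI impI)
    fix u v assume "(u, v) \<in> dir_image l2 q \<and> u \<noteq> v"
    then obtain a b where "u = q a" "v = q b" "(a, b) \<in> l2" "a \<noteq> b"
      unfolding dir_image_def by blast
    moreover from this have "a \<in> Field l2" "b \<in> Field l2"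
      by (auto intro: FieldI1 FieldI2)
    ultimately show "less_D k mu D (g' v) (g' u)"
      using fg(4) g' by simp
  qed
  moreover have "\<forall>a\<in>Field (dir_image l1 p). f' a \<in> prod_mu k mu"
    using fg(1) f' by (simp add: dir_image_Field)
  moreover have "\<forall>x\<in>Field (dir_image l2 q). g' x \<in> prod_mu k mu"
    using fg(2) g' by (simp add: dir_image_Field)
  moreover have "\<forall>a\<in>Field (dir_image l1 p). \<forall>x\<in>Field (dir_image l2 q). less_D k mu D (f' a) (g' x)"
    using fg(5) f' g' by (simp add: dir_image_Field)
  moreover have "\<not> (\<exists>h\<in>prod_mu k mu. \<forall>a\<in>Field (dir_image l1 p). \<forall>x\<in>Field (dir_image l2 q).
      less_D k mu D (f' a) h \<and> less_D k mu D h (g' x))"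
    using fg(6) f' g' by (simp add: dir_image_Field)
  ultimately show ?thesis
    unfolding cut_cofinality_def by blast
qed

lemma infinite_regular_ordIso:
  assumes "infinite_regular r" "r =o s"
  shows "infinite_regular s"
  using assms Cinfinite_cong regularCard_ordIso unfolding infinite_regular_def by blast

lemma Pcut_complete:
  fixes l1 :: "'a rel" and l2 :: "'b rel" and mu :: "'k \<Rightarrow> 'm rel"
  assumes l1: "infinite_regular l1" and l2: "infinite_regular l2"
    and D: "ultrafilter_on (Field k) D" and cut: "cut_cofinality k mu D l1 l2"
  shows "\<exists>(r1 :: ('k \<Rightarrow> 'm) rel) (r2 :: ('k \<Rightarrow> 'm) rel).
    r1 =o l1 \<and> r2 =o l2 \<and> (ordIso `` {r1}, ordIso `` {r2}) \<in> Pcut k mu"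
proof -
  have wo: "Well_order l1" "Well_order l2"
    using l1 l2 by (auto simp: infinite_regular_def card_order_on_def)
  obtain f g where fg:
    "\<forall>a b. (a, b) \<in> l1 \<and> a \<noteq> b \<longrightarrow> less_D k mu D (f a) (f b)"
    "\<forall>x y. (x, y) \<in> l2 \<and> x \<noteq> y \<longrightarrow> less_D k mu D (g y) (g x)"
    using cut unfolding cut_cofinality_def by blast
  have irrefl: "\<not> less_D k mu D h h" for h
    using D by (simp add: less_D_def ultrafilter_on_def)
  have tot: "total_on (Field l1) l1" "total_on (Field l2) l2"
    using wo by (auto simp: well_order_on_def linear_order_on_def)
  have f: "inj_on f (Field l1)"
  proof (rule inj_onI, rule ccontr)
    fix a b assume "a \<in> Field l1" "b \<in> Field l1" "f a = f b" "a \<noteq> b"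
    then show False
      using fg(1) irrefl tot(1) unfolding total_on_def by metis
  qed
  have g: "inj_on g (Field l2)"
  proof (rule inj_onI, rule ccontr)
    fix a b assume "a \<in> Field l2" "b \<in> Field l2" "g a = g b" "a \<noteq> b"
    then show False
      using fg(2) irrefl tot(2) unfolding total_on_def by metis
  qed
  have iso: "l1 =o dir_image l1 f" "l2 =o dir_image l2 g"
    using dir_image_ordIso wo f g by blast+
  have "(ordIso `` {dir_image l1 f}, ordIso `` {dir_image l2 g}) \<in> Pcut k mu"
    unfolding Pcut_def
    using infinite_regular_ordIso[OF l1 iso(1)] infinite_regular_ordIso[OF l2 iso(2)]
      D cut_cofinality_dir_image[OF cut f g] by blast
  then show ?thesis
    using ordIso_symmetric[OF iso(1)] ordIso_symmetric[OF iso(2)] by (intro exI conjI)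
qed

end

theory Submission
  imports Defs
begin

text \<open>
  If \<open>(\<lambda>\<^sub>1, \<lambda>\<^sub>2)\<close> is the cofinality of a cut, then both cardinals are at most \<open>2\<^sup>\<kappa>\<close>. A
  \<open><\<^sub>D\<close>-decreasing sequence longer than \<open>2\<^sup>\<kappa>\<close> would contradict the well-foundedness of the
  coordinates, by a closure argument in the style of elementary submodels. Given \<open>\<lambda>\<^sub>2 \<le> 2\<^sup>\<kappa>\<close>, rounding
  the increasing sequence up to values of the decreasing one yields at most \<open>(2\<^sup>\<kappa>)\<^sup>\<kappa> = 2\<^sup>\<kappa>\<close>
  functions, so for regular \<open>\<lambda>\<^sub>1 > 2\<^sup>\<kappa>\<close> one of them would fill the cut. It remains to count the
  infinite cardinals up to \<open>2\<^sup>\<kappa> = \<aleph>\<^sub>\<alpha>\<close>, of which there are \<open>|\<alpha> + 1| \<le> 2\<^sup>\<kappa>\<close>.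
\<close>

section \<open>Small sets closed under operations of arity \<open>\<kappa>\<close>\<close>

text \<open>A set \<open>T\<close> stands for a term: \<open>z \<in> T\<close> marks an application
  of \<open>F\<close> whose \<open>i\<close>-th argument is coded by the section of \<open>T\<close>
  at \<open>i\<close> along the pairing \<open>e\<close>; without \<open>z\<close> it is the leaf
  \<open>x0\<close>.\<close>

inductive codes ::
  "'i set \<Rightarrow> ('i \<times> 'i \<Rightarrow> 'i) \<Rightarrow> 'i \<Rightarrow> (('i \<Rightarrow> 'a) \<Rightarrow> 'a) \<Rightarrow> 'a \<Rightarrow> 'i set \<Rightarrow> 'a \<Rightarrow> bool"
  for A e z F x0 where
  base: "z \<notin> T \<Longrightarrow> codes A e z F x0 T x0"
| step: "z \<in> T \<Longrightarrow> s \<in> extensional A \<Longrightarrow>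
    (\<And>i. i \<in> A \<Longrightarrow> codes A e z F x0 {x \<in> A. e (i, x) \<in> T} (s i)) \<Longrightarrow>
    codes A e z F x0 T (F s)"

text \<open>Extensionality of \<open>s\<close> lets the codes of its values on \<open>A\<close>
  determine \<open>s\<close> itself, so there are no more values than codes.\<close>

lemma codes_functional:
  "codes A e z F x0 T x \<Longrightarrow> codes A e z F x0 T y \<Longrightarrow> x = y"
proof (induction arbitrary: y rule: codes.induct)
  case (base T)
  from base(2) base(1) show ?case
    by cases auto
next
  case (step T s)
  from step.prems show ?case
  proof cases
    case base
    with step.hyps show ?thesis by simp
  next
    case (step s')
    have "s = s'"
      using \<open>s \<in> extensional A\<close> step(3)
      by (rule extensionalityI) (use step.IH step(4) in blast)
    with step(1) show ?thesis by simp
  qed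
qed

text \<open>
  The elements generated from \<open>x0\<close> by \<open>F\<close> are the values of well-founded terms branching over
  \<open>A\<close>; as \<open>A \<times> A + 1\<close> embeds into \<open>A\<close>, such a term is coded by a subset of \<open>A\<close>.
\<close>

lemma small_closed_set:
  fixes F :: "('i \<Rightarrow> 'a) \<Rightarrow> 'a"
  assumes inf: "infinite A" and x0: "x0 \<in> B" and F: "\<And>s. F s \<in> B"
  obtains X where "X \<subseteq> B" "x0 \<in> X" "\<And>s. s \<in> A \<rightarrow>\<^sub>E X \<Longrightarrow> F s \<in> X" "|X| \<le>o |Pow A|"
proof -
  have "|(A \<times> A) <+> {()}| \<le>o |A|"
  proof (rule card_of_Plus_ordLeq_infinite_Field)
    show "infinite (Field |A| )" using inf by (simp add: Field_card_of)
    show "|A \<times> A| \<le>o |A|"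
      using card_of_Times_same_infinite[OF inf] ordIso_imp_ordLeq by blast
    show "|{()}| \<le>o |A|"
      using inf by (metis card_of_singl_ordLeq finite.emptyI)
    show "Card_order |A|" by (rule card_of_Card_order)
  qed
  then obtain d where d: "inj_on d ((A \<times> A) <+> {()})" "d ` ((A \<times> A) <+> {()}) \<subseteq> A"
    unfolding card_of_ordLeq[symmetric] by (elim exE conjE)
  define e where "e p = d (Inl p)" for p
  define z where "z = d (Inr ())"
  have z: "z \<in> A" using d by (auto simp: z_def)
  have eA: "e (i, x) \<in> A" if "i \<in> A" "x \<in> A" for i x
    using d that by (auto simp: e_def)
  have ez: "e (i, x) \<noteq> z" if "i \<in> A" "x \<in> A" for i x
    using d(1) that by (auto simp: e_def z_def inj_on_def)
  have einj: "i = j \<and> x = y"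
    if "e (i, x) = e (j, y)" "i \<in> A" "x \<in> A" "j \<in> A" "y \<in> A" for i x j y
    using d(1) that by (auto simp: e_def dest!: inj_onD)
  let ?C = "codes A e z F x0"
  define X where "X = {x. \<exists>T. T \<subseteq> A \<and> ?C T x}"
  show thesis
  proof
    show "X \<subseteq> B"
      using x0 F by (auto simp: X_def elim: codes.cases)
    have "?C {} x0" by (rule codes.base) simp
    then show "x0 \<in> X" unfolding X_def by blast
    show "F s \<in> X" if s: "s \<in> A \<rightarrow>\<^sub>E X" for s
    proof -
      have "\<exists>T. T \<subseteq> A \<and> ?C T (s i)" if "i \<in> A" for i
        using PiE_mem[OF s that] by (simp add: X_def)
      then obtain t where t: "\<forall>i\<in>A. t i \<subseteq> A \<and> ?C (t i) (s i)"
        by metis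
      define T where "T = insert z {e (i, x) |i x. i \<in> A \<and> x \<in> t i}"
      have "{x \<in> A. e (i, x) \<in> T} = t i" if "i \<in> A" for i
        using t that ez einj unfolding T_def by blast
      then have "?C T (F s)"
        using s t by (intro codes.step) (auto simp: T_def PiE_def)
      moreover have "T \<subseteq> A"
        using t z eA by (auto simp: T_def)
      ultimately show ?thesis by (auto simp: X_def)
    qed
    have "X \<subseteq> (\<lambda>T. THE x. ?C T x) ` Pow A"
    proof
      fix x assume "x \<in> X"
      then obtain T where T: "T \<subseteq> A" "?C T x" by (auto simp: X_def)
      have "(THE x. ?C T x) = x"
        by (rule the_equality, rule T(2)) (rule codes_functional[OF _ T(2)])
      with T show "x \<in> (\<lambda>T. THE x. ?C T x) ` Pow A" by blast
    qed
    then show "|X| \<le>o |Pow A|"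
      using surj_imp_ordLeq by blast
  qed
qed

section \<open>Cofinalities of cuts\<close>

lemma well_order_argmin:
  assumes "Well_order r" "S \<noteq> {}" "\<And>x. x \<in> S \<Longrightarrow> f x \<in> Field r"
  obtains x where "x \<in> S" "\<And>y. y \<in> S \<Longrightarrow> (f x, f y) \<in> r"
proof -
  interpret wo_rel r using assms(1) by (simp add: wo_rel_def)
  have sub: "f ` S \<subseteq> Field r" "f ` S \<noteq> {}" using assms by auto
  from minim_in[OF sub] obtain x where "x \<in> S" "f x = minim (f ` S)" by auto
  with minim_least[OF sub(1)] that show thesis by auto
qed

lemma infinite_regular_limit:
  assumes "infinite_regular r" "a \<in> Field r"
  obtains b where "b \<in> Field r" "(a, b) \<in> r" "a \<noteq> b"
  using assms infinite_Card_order_limit[of r a]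
  by (auto simp: infinite_regular_def cinfinite_def)

lemma infinite_regular_bounded:
  assumes r: "infinite_regular r" and K: "K \<subseteq> Field r" "|K| <o r"
  obtains b where "b \<in> Field r" "\<And>x. x \<in> K \<Longrightarrow> (x, b) \<in> r \<and> x \<noteq> b"
proof -
  have wo: "Well_order r"
    using r by (simp add: infinite_regular_def card_order_on_def)
  interpret wo_rel r using wo by (simp add: wo_rel_def)
  have "\<not> cofinal K r"
    using r K not_ordLess_ordIso by (auto simp: infinite_regular_def regularCard_def)
  then obtain a where a: "a \<in> Field r" "\<And>x. x \<in> K \<Longrightarrow> a = x \<or> (a, x) \<notin> r"
    unfolding cofinal_def by blast
  \<comment> \<open>Non-cofinality only excludes elements of \<open>K\<close> strictly above
    \<open>a\<close>; a larger \<open>b\<close> is a strict bound.\<close>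
  obtain b where b: "b \<in> Field r" "(a, b) \<in> r" "a \<noteq> b"
    using infinite_regular_limit[OF r a(1)] .
  have "(x, b) \<in> r \<and> x \<noteq> b" if "x \<in> K" for x
  proof -
    have "(x, a) \<in> r"
      using a K that TOTALS REFL by (metis refl_onD subsetD)
    with b TRANS ANTISYM show ?thesis by (metis antisymD transD)
  qed
  with b(1) that show thesis by blast
qed

text \<open>Pigeonhole: if every fiber were bounded, regularity would give some \<open>b\<close>
  strictly above all the chosen bounds, yet \<open>b\<close> lies in a fiber itself.\<close>

lemma infinite_regular_cofinal_fiber:
  fixes p :: "'a \<Rightarrow> 'b"
  assumes r: "infinite_regular r" and P: "p ` Field r \<subseteq> P" "|P| <o r"
  obtains q where "q \<in> P" "\<And>a. a \<in> Field r \<Longrightarrow> \<exists>b\<in>Field r. p b = q \<and> (a, b) \<in> r \<and> a \<noteq> b"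
proof (rule ccontr)
  assume "\<not> thesis"
  with that have "\<forall>q\<in>P. \<exists>a\<in>Field r. \<forall>b\<in>Field r. p b = q \<longrightarrow> \<not> ((a, b) \<in> r \<and> a \<noteq> b)"
    by metis
  then obtain B where B: "\<forall>q\<in>P. B q \<in> Field r \<and>
      (\<forall>b\<in>Field r. p b = q \<longrightarrow> \<not> ((B q, b) \<in> r \<and> B q \<noteq> b))"
    by metis
  have "|B ` P| <o r"
    using P(2) card_of_image ordLeq_ordLess_trans by blast
  moreover have "B ` P \<subseteq> Field r" using B by auto
  ultimately obtain b where "b \<in> Field r" "\<And>x. x \<in> B ` P \<Longrightarrow> (x, b) \<in> r \<and> x \<noteq> b"
    using infinite_regular_bounded[OF r] by blast
  with B P(1) show False by blast
qed

locale well_ordered_ultraproduct =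
  fixes k :: "'k rel" and mu :: "'k \<Rightarrow> 'm rel" and D :: "'k set set"
  assumes k: "Cinfinite k"
    and mu: "\<And>i. i \<in> Field k \<Longrightarrow> Well_order (mu i)"
    and D: "ultrafilter_on (Field k) D"
begin

lemma D_mono: "A \<in> D \<Longrightarrow> A \<subseteq> B \<Longrightarrow> B \<subseteq> Field k \<Longrightarrow> B \<in> D"
  using D by (auto simp: ultrafilter_on_def)

lemma D_mono2: "A \<in> D \<Longrightarrow> B \<in> D \<Longrightarrow> A \<inter> B \<subseteq> C \<Longrightarrow> C \<subseteq> Field k \<Longrightarrow> C \<in> D"
  using D D_mono by (metis ultrafilter_on_def)

abbreviation less (infix "\<prec>" 50) where "f \<prec> g \<equiv> less_D k mu D f g"

definition leq (infix "\<preceq>" 50) where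
  "f \<preceq> g \<longleftrightarrow> {i \<in> Field k. (f i, g i) \<in> mu i} \<in> D"

lemma leq_less_trans: "f \<preceq> g \<Longrightarrow> g \<prec> h \<Longrightarrow> f \<prec> h"
  and less_leq_trans: "f \<prec> g \<Longrightarrow> g \<preceq> h \<Longrightarrow> f \<prec> h"
proof -
  have mu': "(x, z) \<in> mu i \<and> (x = z \<longrightarrow> x = y)"
    if "i \<in> Field k" "(x, y) \<in> mu i" "(y, z) \<in> mu i" for i x y z
    using mu[OF that(1)] that(2,3) unfolding order_on_defs by (metis antisymD transD)
  show "f \<prec> h" if "f \<preceq> g" "g \<prec> h"
    using that[unfolded less_D_def leq_def] unfolding less_D_def
    by (rule D_mono2) (auto dest: mu')
  show "f \<prec> h" if "f \<prec> g" "g \<preceq> h"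
    using that[unfolded less_D_def leq_def] unfolding less_D_def
    by (rule D_mono2) (auto dest: mu')
qed

lemma less_imp_leq: "f \<prec> g \<Longrightarrow> f \<preceq> g"
  unfolding less_D_def leq_def by (erule D_mono) auto

lemma less_trans: "f \<prec> g \<Longrightarrow> g \<prec> h \<Longrightarrow> f \<prec> h"
  using less_imp_leq leq_less_trans by blast

lemma less_irrefl: "\<not> f \<prec> f"
  using D by (simp add: less_D_def ultrafilter_on_def)

lemma Pow_Field: "|Pow (Field k)| =o ctwo ^c k"
  unfolding cexp_def ctwo_def Field_card_of by (rule card_of_Pow_Func)

text \<open>
  Close a set \<open>X\<close> of at most \<open>2\<^sup>\<kappa>\<close> indices under choosing, for a function \<open>h\<close> put together
  coordinatewise from the \<open>g x\<close> with \<open>x \<in> X\<close>, an index \<open>y\<close> with \<open>g y \<prec> h\<close>. If \<open>b\<close> lies above \<open>X\<close>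
  and \<open>h\<close> is the least such function above \<open>g b\<close>, then \<open>g b \<prec> g y\<close> forces \<open>h \<preceq> g y\<close>.
\<close>

lemma decreasing_length:
  assumes l: "infinite_regular l"
    and g: "\<And>x. x \<in> Field l \<Longrightarrow> g x \<in> prod_mu k mu"
    and dec: "\<And>x y. (x, y) \<in> l \<Longrightarrow> x \<noteq> y \<Longrightarrow> g y \<prec> g x"
  shows "l \<le>o ctwo ^c k"
proof (rule ccontr)
  assume "\<not> l \<le>o ctwo ^c k"
  then have small: "ctwo ^c k <o l"
    using l by (simp add: cexp_def card_of_Well_order infinite_regular_def card_order_on_def
        not_ordLeq_iff_ordLess)
  have gF: "g x i \<in> Field (mu i)" if "x \<in> Field l" "i \<in> Field k" for x i
    using g that by (auto simp: prod_mu_def)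
  have infk: "infinite (Field k)" using k by (simp add: cinfinite_def)
  obtain x0 where x0: "x0 \<in> Field l"
    using l by (auto simp: infinite_regular_def cinfinite_def dest: infinite_imp_nonempty)
  define F where "F s = (if \<exists>y\<in>Field l. g y \<prec> (\<lambda>i. g (s i) i)
      then SOME y. y \<in> Field l \<and> g y \<prec> (\<lambda>i. g (s i) i) else x0)" for s
  have F: "F s \<in> Field l \<and> g (F s) \<prec> (\<lambda>i. g (s i) i)"
    if "y \<in> Field l" "g y \<prec> (\<lambda>i. g (s i) i)" for s y
  proof -
    have "\<exists>y. y \<in> Field l \<and> g y \<prec> (\<lambda>i. g (s i) i)" using that by blast
    from someI_ex[OF this] this show ?thesis by (auto simp: F_def)
  qed
  have FB: "F s \<in> Field l" for s
    using F[of _ s] x0 unfolding F_def by metis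
  obtain X where X: "X \<subseteq> Field l" "x0 \<in> X" "\<And>s. s \<in> Field k \<rightarrow>\<^sub>E X \<Longrightarrow> F s \<in> X"
    "|X| \<le>o |Pow (Field k)|"
    using small_closed_set[of "Field k" x0 "Field l" F, OF infk x0 FB] by blast
  have "|X| <o l"
    using X(4) Pow_Field small ordLeq_ordIso_trans ordLeq_ordLess_trans by blast
  then obtain b where b: "b \<in> Field l" "\<And>x. x \<in> X \<Longrightarrow> (x, b) \<in> l \<and> x \<noteq> b"
    using infinite_regular_bounded[OF l X(1)] by blast
  \<comment> \<open>Since \<open>g c \<prec> g b \<preceq> h\<close> for the \<open>h\<close> built
    below, \<open>c\<close> shows that \<open>F\<close> makes a genuine choice there instead of
    returning the default \<open>x0\<close>.\<close>
  obtain c where c: "c \<in> Field l" "(b, c) \<in> l" "b \<noteq> c"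
    using infinite_regular_limit[OF l b(1)] .
  \<comment> \<open>Where no value from \<open>X\<close> reaches \<open>g b i\<close>, any
    \<open>x \<in> X\<close> will do: \<open>g b \<preceq> g y\<close> for \<open>y \<in> X\<close>
    makes such coordinates negligible for \<open>D\<close>.\<close>
  have "\<exists>x\<in>X. (\<exists>y\<in>X. (g b i, g y i) \<in> mu i) \<longrightarrow>
      (g b i, g x i) \<in> mu i \<and> (\<forall>y\<in>X. (g b i, g y i) \<in> mu i \<longrightarrow> (g x i, g y i) \<in> mu i)"
    if i: "i \<in> Field k" for i
  proof (cases "\<exists>y\<in>X. (g b i, g y i) \<in> mu i")
    case True
    then have "{y \<in> X. (g b i, g y i) \<in> mu i} \<noteq> {}" by blast
    then obtain x where "x \<in> {y \<in> X. (g b i, g y i) \<in> mu i}"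
      "\<And>y. y \<in> {y \<in> X. (g b i, g y i) \<in> mu i} \<Longrightarrow> (g x i, g y i) \<in> mu i"
      using well_order_argmin[OF mu[OF i], of _ "\<lambda>y. g y i"] gF[OF _ i] X(1)
      by (smt (verit) mem_Collect_eq subsetD)
    then show ?thesis by blast
  qed (use X(2) in blast)
  then obtain s where s: "\<And>i. i \<in> Field k \<Longrightarrow> s i \<in> X"
    "\<And>i y. i \<in> Field k \<Longrightarrow> y \<in> X \<Longrightarrow> (g b i, g y i) \<in> mu i \<Longrightarrow>
      (g b i, g (s i) i) \<in> mu i \<and> (g (s i) i, g y i) \<in> mu i"
    by metis
  define s' where "s' = restrict s (Field k)"
  define h where "h = (\<lambda>i. g (s' i) i)"
  have h_least: "g b \<preceq> h \<and> h \<preceq> g y" if "y \<in> X" for y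
  proof -
    have "g b \<preceq> g y" using b(2) dec that less_imp_leq by blast
    then show ?thesis
      unfolding leq_def
      by (auto elim!: D_mono simp: h_def s'_def dest: s(2)[OF _ that])
  qed
  have "g c \<prec> h"
    using dec[OF c(2,3)] h_least[OF X(2)] less_leq_trans by blast
  then have "g (F s') \<prec> h"
    using F[OF c(1)] by (simp add: h_def)
  moreover have "F s' \<in> X"
    using X(3) s(1) by (auto simp: s'_def)
  ultimately show False
    using h_least less_leq_trans less_irrefl by blast
qed

text \<open>
  Rounding each \<open>f a\<close> up, coordinatewise, to a value of the decreasing sequence leaves only \<open>2\<^sup>\<kappa>\<close>
  functions; one of them arises from cofinally many \<open>a\<close> and hence lies in the cut.
\<close>

lemma increasing_length:
  assumes l1: "infinite_regular l1" and l2: "infinite_regular l2"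
    and cut: "cut_cofinality k mu D l1 l2"
    and l2_le: "l2 \<le>o ctwo ^c k"
  shows "l1 \<le>o ctwo ^c k"
proof (rule ccontr)
  assume "\<not> l1 \<le>o ctwo ^c k"
  then have small: "ctwo ^c k <o l1"
    using l1 by (simp add: cexp_def card_of_Well_order infinite_regular_def card_order_on_def
        not_ordLeq_iff_ordLess)
  obtain f g where fg:
    "\<forall>x\<in>Field l2. g x \<in> prod_mu k mu"
    "\<forall>a b. (a, b) \<in> l1 \<and> a \<noteq> b \<longrightarrow> f a \<prec> f b"
    "\<forall>x y. (x, y) \<in> l2 \<and> x \<noteq> y \<longrightarrow> g y \<prec> g x"
    "\<forall>a\<in>Field l1. \<forall>x\<in>Field l2. f a \<prec> g x"
    and gap: "\<not> (\<exists>h\<in>prod_mu k mu. \<forall>a\<in>Field l1. \<forall>x\<in>Field l2. f a \<prec> h \<and> h \<prec> g x)"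
    using cut unfolding cut_cofinality_def by blast
  have gF: "g x i \<in> Field (mu i)" if "x \<in> Field l2" "i \<in> Field k" for x i
    using fg(1) that by (auto simp: prod_mu_def)
  obtain x0 where x0: "x0 \<in> Field l2"
    using l2 by (auto simp: infinite_regular_def cinfinite_def dest: infinite_imp_nonempty)
  let ?lt = "\<lambda>a i y. (f a i, g y i) \<in> mu i \<and> f a i \<noteq> g y i"
  \<comment> \<open>Where no value exceeds \<open>f a i\<close>, any index is accepted;
    \<open>f a \<prec> g y\<close> makes these coordinates negligible.\<close>
  define Q where "Q a i x \<longleftrightarrow> x \<in> Field l2 \<and> ((\<exists>y\<in>Field l2. ?lt a i y) \<longrightarrow>
      ?lt a i x \<and> (\<forall>y\<in>Field l2. ?lt a i y \<longrightarrow> (g x i, g y i) \<in> mu i))" for a i x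
  have Q_ex: "\<exists>x. Q a i x"
    if i: "i \<in> Field k" for a i
  proof (cases "\<exists>y\<in>Field l2. ?lt a i y")
    case True
    then have "{y \<in> Field l2. ?lt a i y} \<noteq> {}" by blast
    then obtain x where "x \<in> {y \<in> Field l2. ?lt a i y}"
      "\<And>y. y \<in> {y \<in> Field l2. ?lt a i y} \<Longrightarrow> (g x i, g y i) \<in> mu i"
      using well_order_argmin[OF mu[OF i], of _ "\<lambda>y. g y i"] gF[OF _ i]
      by (smt (verit) mem_Collect_eq)
    then show ?thesis unfolding Q_def by blast
  qed (use x0 in \<open>auto simp: Q_def\<close>)
  define p where "p a i = (SOME x. Q a i x)" for a i
  have Q: "Q a i (p a i)" if "i \<in> Field k" for a i
    unfolding p_def using Q_ex[OF that] by (rule someI_ex)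
  have p: "p a i \<in> Field l2" if "i \<in> Field k" for a i
    using Q[OF that] by (simp add: Q_def)
  have p_least: "?lt a i (p a i) \<and> (g (p a i) i, g y i) \<in> mu i"
    if "i \<in> Field k" "y \<in> Field l2" "?lt a i y" for a i y
    using Q[OF that(1), of a] that(2,3) unfolding Q_def by blast
  define P where "P = Func (Field k) (Field l2)"
  \<comment> \<open>The fixed value off \<open>Field k\<close> puts \<open>p' a\<close> into the
    function space \<open>P\<close>, whose size is computed below.\<close>
  define p' where "p' a i = (if i \<in> Field k then p a i else undefined)" for a i
  define h where "h q = (\<lambda>i\<in>Field k. g (q i) i)" for q
  have h_between: "f a \<prec> h (p' a) \<and> h (p' a) \<preceq> g y" if "a \<in> Field l1" "y \<in> Field l2" for a y
    using fg(4)[rule_format, OF that] unfolding less_D_def leq_def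
    by (auto elim!: D_mono simp: h_def p'_def dest: p_least[OF _ that(2)])
  have "|P| \<le>o (ctwo ^c k) ^c k"
    using cexp_mono1[OF l2_le conjunct2[OF k]] by (simp add: P_def cexp_def)
  also have "(ctwo ^c k) ^c k =o ctwo ^c k"
    using k by (intro cexp_cprod_ordLeq)
      (auto simp: ctwo_def card_of_Card_order ordLeq_refl Cinfinite_Cnotzero)
  finally have "|P| <o l1" using small ordLeq_ordLess_trans by blast
  moreover have "p' ` Field l1 \<subseteq> P" using p by (auto simp: P_def p'_def Func_def)
  ultimately obtain q where q: "q \<in> P"
    "\<And>a. a \<in> Field l1 \<Longrightarrow> \<exists>b\<in>Field l1. p' b = q \<and> (a, b) \<in> l1 \<and> a \<noteq> b"
    using infinite_regular_cofinal_fiber[OF l1] by metis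
  have "h q \<in> prod_mu k mu"
    using q(1) gF by (auto simp: h_def prod_mu_def P_def Func_def)
  moreover have "f a \<prec> h q \<and> h q \<prec> g y" if a: "a \<in> Field l1" and y: "y \<in> Field l2" for a y
  proof -
    obtain b where b: "b \<in> Field l1" "p' b = q" "f a \<prec> f b"
      using q(2)[OF a] fg(2) by blast
    \<comment> \<open>Rounding only gives \<open>h q \<preceq> g c\<close>; taking \<open>c\<close>
      beyond \<open>y\<close> makes \<open>h q \<prec> g y\<close> strict.\<close>
    obtain c where c: "c \<in> Field l2" "(y, c) \<in> l2" "y \<noteq> c"
      using infinite_regular_limit[OF l2 y] .
    show ?thesis
      using h_between[OF b(1) c(1)] b fg(3) c less_trans leq_less_trans by metis
  qed
  ultimately show False using gap by blast
qed

text \<open>The decreasing side comes first, because counting the rounded functions uses the bound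
  on \<open>l2\<close>.\<close>

lemma cut_cofinality_bound:
  assumes l1: "infinite_regular l1" and l2: "infinite_regular l2"
    and cut: "cut_cofinality k mu D l1 l2"
  shows "l1 \<le>o ctwo ^c k" "l2 \<le>o ctwo ^c k"
proof -
  obtain g where "\<forall>x\<in>Field l2. g x \<in> prod_mu k mu"
    "\<forall>x y. (x, y) \<in> l2 \<and> x \<noteq> y \<longrightarrow> g y \<prec> g x"
    using cut unfolding cut_cofinality_def by blast
  then show "l2 \<le>o ctwo ^c k"
    by (intro decreasing_length[OF l2]) auto
  then show "l1 \<le>o ctwo ^c k"
    by (rule increasing_length[OF assms])
qed

end

section \<open>Counting the cardinals below a bound\<close>

definition infinite_cards_upto :: "'c rel \<Rightarrow> 'a rel set set" where
  "infinite_cards_upto c = {ordIso `` {l} | l :: 'a rel. Cinfinite l \<and> l \<le>o c}"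

lemma ordIso_class_cong:
  fixes r :: "'a rel" and s :: "'b rel"
  assumes "r =o s"
  shows "ordIso `` {r} = (ordIso `` {s} :: 'c rel set)"
proof -
  have "r =o t \<longleftrightarrow> s =o t" for t :: "'c rel"
    using ordIso_transitive[OF assms, of t] ordIso_transitive[OF ordIso_symmetric[OF assms], of t]
    by metis
  then show ?thesis by auto
qed

text \<open>\<open>H\<close> covers the infinite cardinals strictly below \<open>c\<close>, and the
  point of \<open>cone\<close> stands for \<open>c\<close> itself; this is the source of the 1 in
  \<alpha> + 1.\<close>

lemma infinite_cards_upto_card:
  fixes c :: "'c rel" and H :: "'d \<Rightarrow> 'e rel"
  assumes "\<And>l :: 'a rel. Cinfinite l \<Longrightarrow> l <o c \<Longrightarrow> \<exists>a\<in>Field r. l =o H a"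
  shows "|infinite_cards_upto c :: 'a rel set set| \<le>o r +c cone"
proof -
  let ?C = "infinite_cards_upto c :: 'a rel set set"
  let ?h = "\<lambda>v. case v of Inl a \<Rightarrow> ordIso `` {H a} | Inr _ \<Rightarrow> (ordIso `` {c} :: 'a rel set)"
  have "?C \<subseteq> ?h ` (Field r <+> Field cone)"
  proof
    fix u assume "u \<in> ?C"
    then obtain l :: "'a rel" where l: "u = ordIso `` {l}" "Cinfinite l" "l \<le>o c"
      by (auto simp: infinite_cards_upto_def)
    from l(3) consider "l <o c" | "l =o c" using ordLeq_iff_ordLess_or_ordIso by blast
    then show "u \<in> ?h ` (Field r <+> Field cone)"
    proof cases
      case 1
      then obtain a where "a \<in> Field r" "l =o H a" using assms l by blast
      then show ?thesis
        using ordIso_class_cong l(1) by (intro image_eqI[of _ _ "Inl a"]) auto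
    next
      case 2
      then show ?thesis
        using ordIso_class_cong l(1)
        by (intro image_eqI[of _ _ "Inr ()"]) (auto simp: cone_def Field_card_of)
    qed
  qed
  then show ?thesis
    unfolding csum_def by (rule surj_imp_ordLeq)
qed

lemma infinite_cards_upto_le:
  assumes c: "Cinfinite c"
  shows "|infinite_cards_upto c :: 'a rel set set| \<le>o c"
proof -
  have wo: "Well_order c" using c by (simp add: card_order_on_def)
  have "|infinite_cards_upto c :: 'a rel set set| \<le>o c +c cone"
    \<comment> \<open>A cardinal below \<open>c\<close> is isomorphic to a proper initial segment of
      \<open>c\<close>, so the elements of \<open>c\<close> index them.\<close>
    by (rule infinite_cards_upto_card[where H = "\<lambda>a. Restr c (underS c a)"])
      (use wo ordLess_iff_ordIso_Restr[OF wo] card_order_on_well_order_on in blast)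
  also have "c +c cone =o c"
    using c by (intro csum_absorb1 cone_ordLeq_Cnotzero Cinfinite_Cnotzero)
  finally show ?thesis .
qed

section \<open>Alephs indexed by well-orders\<close>

lemma is_aleph_Card_order: "is_aleph r c \<Longrightarrow> Card_order c"
  by (cases rule: is_aleph.cases) auto

text \<open>The clauses exclude each other: \<open>r\<close> is empty, has a maximum, or is nonempty
  without one. At limits \<open>c\<close> and \<open>c'\<close> each bound the other's family; they
  share the type \<open>'u\<close>, so leastness applies both ways.\<close>

lemma is_aleph_unique:
  fixes c c' :: "'u rel"
  shows "is_aleph r c \<Longrightarrow> is_aleph r c' \<Longrightarrow> c =o c'"
proof (induction arbitrary: c' rule: is_aleph.induct)
  case (zero c)
  from zero.prems show ?case
  proof cases
    case zero
    with \<open>c =o natLeq\<close> show ?thesis by (metis ordIso_symmetric ordIso_transitive)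
  qed auto
next
  case (succ r a d c)
  from succ.prems show ?case
  proof cases
    case zero
    with succ.hyps show ?thesis by simp
  next
    case succ': (succ a' d')
    have "antisym r" using succ.hyps(1) by (auto simp: order_on_defs)
    then have "a' = a"
      using succ.hyps(2,3) succ'(2,3) by (auto dest: antisymD FieldI1)
    then have "d =o d'" using succ'(4) succ.IH by blast
    then have "cardSuc d =o cardSuc d'"
      using cardSuc_invar_ordIso[OF is_aleph_Card_order[OF succ.hyps(4)] is_aleph_Card_order[OF succ'(4)]]
      by simp
    then show ?thesis
      using ordIso_transitive[OF succ.hyps(6)] ordIso_symmetric[OF succ'(6)]
      by (metis ordIso_transitive)
  next
    case limit
    then obtain b where "(a, b) \<in> r" "a \<noteq> b" using succ.hyps(2) by blast
    moreover have "(b, a) \<in> r" using \<open>(a, b) \<in> r\<close> succ.hyps(3) by (auto simp: Field_def)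
    moreover have "antisym r" using succ.hyps(1) by (auto simp: order_on_defs)
    ultimately show ?thesis by (meson antisymD)
  qed
next
  case (limit r A c)
  from limit.prems show ?case
  proof cases
    case zero
    with limit.hyps show ?thesis by simp
  next
    case (succ a d)
    obtain b where "(a, b) \<in> r" "a \<noteq> b" using limit.hyps(3) succ(2) by blast
    moreover have "(b, a) \<in> r" using \<open>(a, b) \<in> r\<close> succ(3) by (auto simp: Field_def)
    moreover have "antisym r" using succ(1) by (auto simp: order_on_defs)
    ultimately show ?thesis by (meson antisymD)
  next
    case limit': (limit A')
    have iso: "A a =o A' a" if "a \<in> Field r" for a
      using limit.IH limit'(4) that by blast
    have "A a \<le>o c'" if "a \<in> Field r" for a
      using iso[OF that] limit'(6)[OF that] by (rule ordIso_ordLeq_trans)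
    then have "c \<le>o c'" using limit.hyps limit'(5) by blast
    moreover have "A' a \<le>o c" if "a \<in> Field r" for a
      using ordIso_symmetric[OF iso[OF that]] limit.hyps(6)[OF that] by (rule ordIso_ordLeq_trans)
    then have "c' \<le>o c" using limit'(7) limit.hyps(5) by blast
    ultimately show ?thesis by (simp add: ordIso_iff_ordLeq)
  qed
qed

text \<open>Carries an index found by induction inside an initial segment back to
  \<open>r\<close>.\<close>

lemma Restr_underS_Restr_underS:
  assumes "Well_order r" "b \<in> Field (Restr r (underS r a))"
  shows "b \<in> Field r"
    "Restr (Restr r (underS r a)) (underS (Restr r (underS r a)) b) = Restr r (underS r b)"
proof -
  have r: "trans r" "antisym r" using assms(1) by (auto simp: order_on_defs)
  have b: "b \<in> underS r a" using subsetD[OF Field_Restr_subset assms(2)] .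
  show "b \<in> Field r" using assms(2) by (auto simp: Field_def)
  have sub: "(x, a) \<in> r \<and> x \<noteq> a" if "(x, b) \<in> r" for x
  proof -
    have ba: "(b, a) \<in> r" "b \<noteq> a" using b by (auto simp: underS_def)
    have "x \<noteq> a" using antisymD[OF r(2) ba(1)] ba(2) that by blast
    with transD[OF r(1) that ba(1)] show ?thesis by simp
  qed
  have "underS (Restr r (underS r a)) b = underS r b"
    using b by (auto simp: underS_def dest: sub)
  moreover have "underS r b \<subseteq> underS r a"
    by (auto simp: underS_def dest: sub)
  ultimately show
    "Restr (Restr r (underS r a)) (underS (Restr r (underS r a)) b) = Restr r (underS r b)"
    by (simp add: Restr_subset)
qed

text \<open>The alephs skip no infinite cardinal: nothing lies strictly between \<open>d\<close> and
  \<open>cardSuc d\<close>, and at a limit some \<open>A a\<close> exceeds \<open>l\<close>, as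
  \<open>c\<close> is the least bound.\<close>

lemma infinite_card_below_aleph:
  fixes l :: "'l rel" and c :: "'u rel"
  assumes "is_aleph r c" and l: "Cinfinite l"
  shows "l <o c \<Longrightarrow> \<exists>a\<in>Field r. \<exists>d :: 'u rel. is_aleph (Restr r (underS r a)) d \<and> l =o d"
  using assms(1)
proof (induction rule: is_aleph.induct)
  case (zero c)
  have "c \<le>o l"
    using zero.hyps(2) natLeq_ordLeq_cinfinite[OF l] by (rule ordIso_ordLeq_trans)
  with zero.prems show ?case using not_ordLess_ordLeq by blast
next
  case (succ r a d c)
  have "l <o cardSuc d" using succ.prems succ.hyps(6) by (rule ordLess_ordIso_trans)
  then have "l \<le>o d"
    using cardSuc_ordLeq_ordLess[OF is_aleph_Card_order[OF succ.hyps(4)], of l] l by simp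
  then consider "l =o d" | "l <o d" using ordLeq_iff_ordLess_or_ordIso by blast
  then show ?case
  proof cases
    case 1
    with succ.hyps show ?thesis by blast
  next
    case 2
    from succ.IH[OF this] show ?thesis
      using Restr_underS_Restr_underS[OF succ.hyps(1)] by metis
  qed
next
  case (limit r A c)
  \<comment> \<open>Leastness in the limit clause speaks of cardinals on \<open>'u\<close> only, so
    \<open>l\<close> is first copied to that type.\<close>
  obtain l' :: "'u rel" where l': "l =o l'"
    using limit.prems internalize_ordLess[of l c] by auto
  then have co: "Card_order l'" using l Card_order_ordIso2 by blast
  have "\<not> c \<le>o l'"
    using ordIso_ordLess_trans[OF ordIso_symmetric[OF l'] limit.prems] not_ordLess_ordLeq by auto
  then obtain a where a: "a \<in> Field r" "\<not> A a \<le>o l'"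
    using limit.hyps(7)[OF co] by blast
  have "l' <o A a"
    using a(2) co is_aleph_Card_order[OF limit.hyps(4)[OF a(1)]]
    by (simp add: card_order_on_def not_ordLeq_iff_ordLess)
  with l' have "l <o A a" by (rule ordIso_ordLess_trans)
  from limit.IH[OF a(1) this] show ?case
    using Restr_underS_Restr_underS[OF limit.hyps(1)] by metis
qed

lemma infinite_cards_upto_aleph:
  fixes c :: "'u rel"
  assumes "is_aleph r c"
  shows "|infinite_cards_upto c :: 'a rel set set| \<le>o r +c cone"
proof (rule infinite_cards_upto_card)
  fix l :: "'a rel" assume "Cinfinite l" "l <o c"
  from infinite_card_below_aleph[OF assms this] obtain a and d :: "'u rel"
    where a: "a \<in> Field r" "is_aleph (Restr r (underS r a)) d" "l =o d" by blast
  \<comment> \<open>The choice turns the aleph at index \<open>a\<close> into a function of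
    \<open>a\<close>; uniqueness identifies it with \<open>d\<close>.\<close>
  let ?d = "SOME d :: 'u rel. is_aleph (Restr r (underS r a)) d"
  have "is_aleph (Restr r (underS r a)) ?d" using a(2) by (rule someI)
  with a show "\<exists>a\<in>Field r. l =o (SOME d :: 'u rel. is_aleph (Restr r (underS r a)) d)"
    using ordIso_transitive[OF a(3) is_aleph_unique] by blast
qed

lemma Times_self_le_cexp_ctwo:
  assumes "|A| \<le>o r"
  shows "|A \<times> A| \<le>o r ^c ctwo"
proof -
  have "|A| \<le>o |Field r|"
    using assms card_of_mono2[OF assms] by (simp add: Field_card_of)
  then obtain j where j: "inj_on j A" "j ` A \<subseteq> Field r"
    unfolding card_of_ordLeq[symmetric] by (elim exE conjE)
  \<comment> \<open>\<open>ctwo\<close> lives on the booleans, so a pair becomes a function on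
    them.\<close>
  have "inj_on (\<lambda>(x, y) b. if b then j x else j y) (A \<times> A)"
    using j(1) by (auto simp: inj_on_def fun_eq_iff)
  moreover have "(\<lambda>(x, y) b. if b then j x else j y) ` (A \<times> A) \<subseteq> Func (Field ctwo) (Field r)"
    using j(2) by (auto simp: Func_def ctwo_def Field_card_of)
  ultimately show ?thesis
    unfolding cexp_def by (intro card_of_ordLeqI) auto
qed

section \<open>The bounds on the set of cut cofinalities\<close>

theorem theorem2p1:
  fixes k :: "'k rel" and mu :: "'k \<Rightarrow> 'm rel"
  assumes "infinite_regular k"
    and "\<And>i. i \<in> Field k \<Longrightarrow> infinite_regular (mu i)"
    and "\<And>i j. (i, j) \<in> k \<Longrightarrow> i \<noteq> j \<Longrightarrow> mu i <o mu j"
  shows "|Pcut k mu| \<le>o ctwo ^c k \<and>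
    (\<forall>\<alpha> :: 'o rel. is_aleph \<alpha> (ctwo ^c k) \<longrightarrow> |Pcut k mu| \<le>o (\<alpha> +c cone) ^c ctwo)"
proof -
  have k: "Cinfinite k" using assms(1) by (simp add: infinite_regular_def)
  have mu: "Well_order (mu i)" if "i \<in> Field k" for i
    using assms(2)[OF that] by (simp add: infinite_regular_def card_order_on_def)
  let ?C = "infinite_cards_upto (ctwo ^c k) :: ('k \<Rightarrow> 'm) rel set set"
  have "Pcut k mu \<subseteq> ?C \<times> ?C"
  proof
    fix u assume "u \<in> Pcut k mu"
    then obtain l1 l2 :: "('k \<Rightarrow> 'm) rel" and D
      where u: "u = (ordIso `` {l1}, ordIso `` {l2})"
        and l: "infinite_regular l1" "infinite_regular l2"
        and D: "ultrafilter_on (Field k) D" and cut: "cut_cofinality k mu D l1 l2"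
      unfolding Pcut_def by blast
    interpret well_ordered_ultraproduct k mu D
      using k mu D by unfold_locales
    show "u \<in> ?C \<times> ?C"
      using u l cut_cofinality_bound[OF l cut]
      by (auto simp: infinite_cards_upto_def infinite_regular_def)
  qed
  then have Pcut_le: "|Pcut k mu| \<le>o |?C \<times> ?C|" by (rule card_of_mono1)
  have c: "Cinfinite (ctwo ^c k)"
    using k by (intro Cinfinite_cexp) (auto simp: ctwo_def card_of_Card_order ordLeq_refl)
  have "|Pcut k mu| \<le>o ctwo ^c k"
    using card_of_Times_ordLeq_infinite_Field[of "ctwo ^c k" ?C ?C] infinite_cards_upto_le[OF c] c
      ordLeq_transitive[OF Pcut_le] by (auto simp: cinfinite_def)
  moreover have "|Pcut k mu| \<le>o (\<alpha> +c cone) ^c ctwo" if "is_aleph \<alpha> (ctwo ^c k)" for \<alpha> :: "'o rel"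
    using Pcut_le Times_self_le_cexp_ctwo[OF infinite_cards_upto_aleph[OF that]]
    by (rule ordLeq_transitive)
  ultimately show ?thesis by blast
qed

end
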